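(* Let $n\ge3$ and let $d_n>0$ be a constant such that for all compact manifolds $N$ of dimension $n$ with $\sigma(N)>0$ and all $a\in(0,\sigma(N))$, $$X^N_+(a)\le d_n\,\frac{(\sigma(S^n)-a)^{1/n}}{a}.$$ Suppose that $M$ is a compact manifold of dimension $n$ with $\sigma(M)>0$ such that $$\frac{d_n}{\sigma(S^n)}<\limsup_{\varepsilon\to0^+}\frac{X^M_+(\sigma(M)-\varepsilon)}{\varepsilon^{1/n}}.$$ Then $\sigma(M)<\sigma(S^n)$.
   Context: Compact manifold means closed (compact without boundary) smooth manifold, not necessarily connected. For a Riemannian metric $g$ on a compact manifold $M$ of dimension $n\ge3$, let $s_g$ be the scalar curvature, $\Delta_g$ the Laplace-Beltrami operator with non-negative spectrum, $L_g=\Delta_g+\frac{n-2}{4(n-1)}s_g$ the conformal Laplacian, $p_n=\frac{2n}{n-2}$, $$Y(g)=\inf\Big\{\frac{\int_M uL_gu\,dv^g}{\|u\|_{L^{p_n}}^2}\ \Big|\ u\in C^\infty(M)\setminus\{0\}\Big\}$$ the Yamabe constant, and $\sigma(M)=\sup_g Y(g)$, the supremum over all Riemannian metrics $g$ on $M$, the (smooth) Yamabe invariant. $S^n$ is the $n$-sphere. A constant $d_n$ as in the claim exists for every $n\ge3$. Mass: if $g$ is flat on an open neighbourhood of $p\in M$ and $Y(g)>0$, there is a unique Green function $G_g$ of $L_g$ at $p$ ($L_gG_g=\delta_p$ in the sense of distributions), and as $x\to p$, $G_g(x)=\frac{1}{(n-2)\omega_{n-1}r(x)^{n-2}}+m(g,p)+o(1)$,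 where $\omega_{n-1}$ is the volume of the standard sphere $S^{n-1}$ and $r$ is the $g$-distance to $p$. The number $m(g,p)\in\mathbb{R}$ is the mass of $g$ at $p$. For $b\in[0,\sigma(M))$ let $\Omega^b_M$ be the set of pairs $(g,p)$, $g$ a Riemannian metric on $M$ and $p\in M$, such that $Y(g)>b$ and the ball $B^g_p(1)$ of centre $p$ and radius $1$ for $g$ is isometric to the standard Euclidean unit ball of dimension $n$. If $\sigma(M)>0$, the upper mass function $X^M_+:[0,\sigma(M)]\to\mathbb{R}\cup\{\pm\infty\}$ is $$X^M_+(a)=\limsup_{\varepsilon\to0^+}\ \sup_{(g,p)\in\Omega_M^{\max(a-\varepsilon,0)}}m(g,p).$$ *)

theory Defs
  imports "HOL-Analysis.Analysis"
begin

section \<open>Smooth maps between Euclidean spaces\<close>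

text \<open>Only meant for open \<open>S\<close>.\<close>

fun Ck_on :: "nat \<Rightarrow> 'e::euclidean_space set \<Rightarrow> ('e \<Rightarrow> 'f::real_normed_vector) \<Rightarrow> bool" where
  "Ck_on 0 S f \<longleftrightarrow> continuous_on S f"
| "Ck_on (Suc k) S f \<longleftrightarrow>
     (\<forall>x\<in>S. f differentiable (at x)) \<and>
     (\<forall>v. Ck_on k S (\<lambda>x. frechet_derivative f (at x) v))"

definition smooth_on :: "'e::euclidean_space set \<Rightarrow> ('e \<Rightarrow> 'f::real_normed_vector) \<Rightarrow> bool" where
  "smooth_on S f \<longleftrightarrow> (\<forall>k. Ck_on k S f)"

definition pderiv_at :: "'n::finite \<Rightarrow> (real ^ 'n \<Rightarrow> real) \<Rightarrow> real ^ 'n \<Rightarrow> real" where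
  "pderiv_at i f x = deriv (\<lambda>t. f (x + t *\<^sub>R axis i 1)) 0"


section \<open>Closed smooth manifolds\<close>

text \<open>
  A chart is a pair (domain, coordinate map); its coordinate map is only relevant on the domain.
  A manifold of dimension \<open>CARD('n)\<close> is given by a topology whose points have type \<open>'a\<close> and
  a (not necessarily maximal) smooth atlas. The points may form an arbitrary subset of \<open>'a\<close>,
  and the topology is unrelated to any topology on \<open>'a\<close>. Hence, as soon as the cardinality of
  \<open>'a\<close> is at least that of the continuum, every compact manifold of dimension \<open>CARD('n)\<close> is
  diffeomorphic to one with points in \<open>'a\<close>. This cardinality condition holds whenever
  there is a nonempty manifold of positive dimension with points in \<open>'a\<close>.
\<close>

type_synonym ('a, 'n) chart = "'a set \<times> ('a \<Rightarrow> real ^ 'n)"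

record ('a, 'n) manifold =
  mtop :: "'a topology"
  atlas :: "('a, 'n) chart set"

abbreviation points :: "('a, 'n::finite) manifold \<Rightarrow> 'a set" where
  "points M \<equiv> topspace (mtop M)"

abbreviation cdom :: "('a, 'n::finite) chart \<Rightarrow> 'a set" where
  "cdom c \<equiv> fst c"

abbreviation cmap :: "('a, 'n::finite) chart \<Rightarrow> 'a \<Rightarrow> real ^ 'n" where
  "cmap c \<equiv> snd c"

abbreviation cinv :: "('a, 'n::finite) chart \<Rightarrow> real ^ 'n \<Rightarrow> 'a" where
  "cinv c \<equiv> inv_into (cdom c) (cmap c)"

abbreviation cimg :: "('a, 'n::finite) chart \<Rightarrow> (real ^ 'n) set" where
  "cimg c \<equiv> cmap c ` cdom c"

definition smooth_atlas :: "('a, 'n::finite) manifold \<Rightarrow> bool" where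
  "smooth_atlas M \<longleftrightarrow>
     (\<forall>c\<in>atlas M. openin (mtop M) (cdom c) \<and> open (cimg c) \<and>
        homeomorphic_map (subtopology (mtop M) (cdom c)) (top_of_set (cimg c)) (cmap c)) \<and>
     \<Union> (cdom ` atlas M) = points M \<and>
     (\<forall>c\<in>atlas M. \<forall>c'\<in>atlas M.
        smooth_on (cmap c ` (cdom c \<inter> cdom c')) (cmap c' \<circ> cinv c))"

text \<open>Second countability follows from compactness. Manifolds are taken to be nonempty, since
  the Yamabe constant is an infimum over the nonzero smooth functions.\<close>

definition compact_manifold :: "('a, 'n::finite) manifold \<Rightarrow> bool" where
  "compact_manifold M \<longleftrightarrow>
     points M \<noteq> {} \<and> Hausdorff_space (mtop M) \<and> compact_space (mtop M) \<and> smooth_atlas M"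

text \<open>The choice of the chart does not matter wherever \<open>chart_at\<close> is used below: all the local
  expressions evaluated in it are invariant under coordinate changes.\<close>

definition chart_at :: "('a, 'n::finite) manifold \<Rightarrow> 'a \<Rightarrow> ('a, 'n) chart" where
  "chart_at M p = (SOME c. c \<in> atlas M \<and> p \<in> cdom c)"

definition smooth_fun_on :: "('a, 'n::finite) manifold \<Rightarrow> 'a set \<Rightarrow> ('a \<Rightarrow> real) \<Rightarrow> bool" where
  "smooth_fun_on M W u \<longleftrightarrow> (\<forall>c\<in>atlas M. smooth_on (cmap c ` (cdom c \<inter> W)) (u \<circ> cinv c))"

text \<open>The sphere \<open>S\<^sup>n\<close>, \<open>n = CARD('n)\<close>, as the unit sphere of \<open>\<real>\<^sup>n \<times> \<real>\<close> with the two
  stereographic projections as atlas.\<close>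

definition sphere_manifold :: "((real ^ 'n) \<times> real, 'n::finite) manifold" where
  "sphere_manifold =
     \<lparr> mtop = top_of_set (sphere 0 1),
       atlas = {(sphere 0 1 - {(0, 1)}, \<lambda>(x, t). x /\<^sub>R (1 - t)),
                (sphere 0 1 - {(0, -1)}, \<lambda>(x, t). x /\<^sub>R (1 + t))} \<rparr>"


section \<open>Riemannian metrics\<close>

text \<open>A metric is represented by its coefficient matrices: \<open>g c x $ i $ j\<close> is the coefficient
  \<open>g\<^sub>i\<^sub>j\<close> in the chart \<open>c\<close>, at the point with coordinates \<open>x\<close>. The values for \<open>c\<close> outside
  the atlas or \<open>x\<close> outside the image of \<open>c\<close> are irrelevant.\<close>

type_synonym ('a, 'n) metric_coeffs = "('a, 'n) chart \<Rightarrow> real ^ 'n \<Rightarrow> real ^ 'n ^ 'n"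

definition riemannian_metric ::
  "('a, 'n::finite) manifold \<Rightarrow> ('a, 'n) metric_coeffs \<Rightarrow> bool" where
  "riemannian_metric M g \<longleftrightarrow>
     (\<forall>c\<in>atlas M. smooth_on (cimg c) (g c) \<and>
        (\<forall>x\<in>cimg c. transpose (g c x) = g c x \<and> (\<forall>v. v \<noteq> 0 \<longrightarrow> v \<bullet> (g c x *v v) > 0))) \<and>
     (\<forall>c\<in>atlas M. \<forall>c'\<in>atlas M. \<forall>p \<in> cdom c \<inter> cdom c'.
        let J = matrix (frechet_derivative (cmap c' \<circ> cinv c) (at (cmap c p)))
        in g c (cmap c p) = transpose J ** g c' (cmap c' p) ** J)"

subsection \<open>Curvature\<close>

definition christoffel ::
  "(real ^ 'n \<Rightarrow> real ^ 'n ^ 'n) \<Rightarrow> 'n::finite \<Rightarrow> 'n \<Rightarrow> 'n \<Rightarrow> real ^ 'n \<Rightarrow> real" where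
  "christoffel h k i j x = 1/2 * (\<Sum>l\<in>UNIV. matrix_inv (h x) $ k $ l *
     (pderiv_at i (\<lambda>y. h y $ j $ l) x + pderiv_at j (\<lambda>y. h y $ i $ l) x
        - pderiv_at l (\<lambda>y. h y $ i $ j) x))"

text \<open>\<open>riemann_coeff h l k i j\<close> is the \<open>l\<close>-th component of \<open>R(\<partial>\<^sub>i, \<partial>\<^sub>j)\<partial>\<^sub>k\<close>, with
  \<open>R(X,Y) = \<nabla>\<^sub>X\<nabla>\<^sub>Y - \<nabla>\<^sub>Y\<nabla>\<^sub>X - \<nabla>\<^sub>[\<^sub>X\<^sub>,\<^sub>Y\<^sub>]\<close>; the Ricci tensor is
  \<open>Ric(Y,Z) = tr (X \<mapsto> R(X,Y)Z)\<close>, so that round spheres have positive scalar curvature.\<close>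

definition riemann_coeff ::
  "(real ^ 'n \<Rightarrow> real ^ 'n ^ 'n) \<Rightarrow> 'n::finite \<Rightarrow> 'n \<Rightarrow> 'n \<Rightarrow> 'n \<Rightarrow> real ^ 'n \<Rightarrow> real" where
  "riemann_coeff h l k i j x =
     pderiv_at i (christoffel h l j k) x - pderiv_at j (christoffel h l i k) x
     + (\<Sum>m\<in>UNIV. christoffel h l i m x * christoffel h m j k x
                  - christoffel h l j m x * christoffel h m i k x)"

definition ricci_coeff ::
  "(real ^ 'n \<Rightarrow> real ^ 'n ^ 'n) \<Rightarrow> 'n::finite \<Rightarrow> 'n \<Rightarrow> real ^ 'n \<Rightarrow> real" where
  "ricci_coeff h j k x = (\<Sum>i\<in>UNIV. riemann_coeff h i k i j x)"

definition scalar_curvature ::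
  "('a, 'n::finite) manifold \<Rightarrow> ('a, 'n) metric_coeffs \<Rightarrow> 'a \<Rightarrow> real" where
  "scalar_curvature M g p =
     (let c = chart_at M p; x = cmap c p
      in \<Sum>j\<in>UNIV. \<Sum>k\<in>UNIV. matrix_inv (g c x) $ j $ k * ricci_coeff (g c) j k x)"

subsection \<open>Laplace-Beltrami operator and conformal Laplacian\<close>

text \<open>The sign makes the spectrum of the Laplacian non-negative.\<close>

definition laplacian ::
  "('a, 'n::finite) manifold \<Rightarrow> ('a, 'n) metric_coeffs \<Rightarrow> ('a \<Rightarrow> real) \<Rightarrow> 'a \<Rightarrow> real" where
  "laplacian M g u p =
     (let c = chart_at M p; h = g c; x = cmap c p
      in - (1 / sqrt (det (h x))) *
           (\<Sum>i\<in>UNIV. pderiv_at i (\<lambda>y. sqrt (det (h y)) *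
              (\<Sum>j\<in>UNIV. matrix_inv (h y) $ i $ j * pderiv_at j (u \<circ> cinv c) y)) x))"

definition conformal_laplacian ::
  "('a, 'n::finite) manifold \<Rightarrow> ('a, 'n) metric_coeffs \<Rightarrow> ('a \<Rightarrow> real) \<Rightarrow> 'a \<Rightarrow> real" where
  "conformal_laplacian M g u p =
     laplacian M g u p
     + (real CARD('n) - 2) / (4 * (real CARD('n) - 1)) * scalar_curvature M g p * u p"

subsection \<open>Riemannian volume measure and distance\<close>

text \<open>The unique Borel measure given by \<open>sqrt (det g) dx\<close> in every chart.\<close>

definition volume_measure ::
  "('a, 'n::finite) manifold \<Rightarrow> ('a, 'n) metric_coeffs \<Rightarrow> 'a measure" where
  "volume_measure M g = (THE \<mu>.
     space \<mu> = points M \<and>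
     sets \<mu> = sigma_sets (points M) {U. openin (mtop M) U} \<and>
     (\<forall>c\<in>atlas M. \<forall>B\<in>sets \<mu>. B \<subseteq> cdom c \<longrightarrow>
        emeasure \<mu> B =
          (\<integral>\<^sup>+x. indicator (cmap c ` B) x * ennreal (sqrt (det (g c x))) \<partial>lborel)))"

definition piecewise_C1_curve :: "('a, 'n::finite) manifold \<Rightarrow> (real \<Rightarrow> 'a) \<Rightarrow> bool" where
  "piecewise_C1_curve M \<gamma> \<longleftrightarrow>
     continuous_map (top_of_set {0..1}) (mtop M) \<gamma> \<and>
     (\<forall>c\<in>atlas M. \<forall>a b. 0 \<le> a \<and> a < b \<and> b \<le> 1 \<and> \<gamma> ` {a..b} \<subseteq> cdom c \<longrightarrow>
        (cmap c \<circ> \<gamma>) piecewise_C1_differentiable_on {a..b})"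

definition speed ::
  "('a, 'n::finite) manifold \<Rightarrow> ('a, 'n) metric_coeffs \<Rightarrow> (real \<Rightarrow> 'a) \<Rightarrow> real \<Rightarrow> real" where
  "speed M g \<gamma> t =
     (let c = chart_at M (\<gamma> t); v = vector_derivative (cmap c \<circ> \<gamma>) (at t)
      in sqrt (v \<bullet> (g c (cmap c (\<gamma> t)) *v v)))"

definition curve_length ::
  "('a, 'n::finite) manifold \<Rightarrow> ('a, 'n) metric_coeffs \<Rightarrow> (real \<Rightarrow> 'a) \<Rightarrow> ennreal" where
  "curve_length M g \<gamma> = (\<integral>\<^sup>+t. indicator {0..1} t * ennreal (speed M g \<gamma> t) \<partial>lborel)"

text \<open>The distance between points of different connected components is \<open>\<infinity>\<close>.\<close>

definition riem_dist ::
  "('a, 'n::finite) manifold \<Rightarrow> ('a, 'n) metric_coeffs \<Rightarrow> 'a \<Rightarrow> 'a \<Rightarrow> ennreal" where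
  "riem_dist M g p q =
     (INF \<gamma>\<in>{\<gamma>. piecewise_C1_curve M \<gamma> \<and> \<gamma> 0 = p \<and> \<gamma> 1 = q}. curve_length M g \<gamma>)"

definition riem_ball ::
  "('a, 'n::finite) manifold \<Rightarrow> ('a, 'n) metric_coeffs \<Rightarrow> 'a \<Rightarrow> real \<Rightarrow> 'a set" where
  "riem_ball M g p r = {q \<in> points M. riem_dist M g p q < ennreal r}"

text \<open>Existence of a diffeomorphism \<open>F\<close> from the Euclidean unit ball onto \<open>B\<close> that pulls
  \<open>g\<close> back to the Euclidean metric; for \<open>B\<close> an open set.\<close>

definition isometric_to_unit_ball ::
  "('a, 'n::finite) manifold \<Rightarrow> ('a, 'n) metric_coeffs \<Rightarrow> 'a set \<Rightarrow> bool" where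
  "isometric_to_unit_ball M g B \<longleftrightarrow>
     (\<exists>F :: real ^ 'n \<Rightarrow> 'a.
        homeomorphic_map (top_of_set (ball 0 1)) (subtopology (mtop M) B) F \<and>
        (\<forall>c\<in>atlas M.
           smooth_on {x \<in> ball 0 1. F x \<in> cdom c} (cmap c \<circ> F) \<and>
           smooth_on (cmap c ` (cdom c \<inter> B)) (inv_into (ball 0 1) F \<circ> cinv c) \<and>
           (\<forall>x \<in> ball 0 1. F x \<in> cdom c \<longrightarrow>
              (let J = matrix (frechet_derivative (cmap c \<circ> F) (at x))
               in transpose J ** g c (cmap c (F x)) ** J = mat 1))))"


section \<open>Yamabe constant and Yamabe invariant\<close>

definition Lp_norm :: "'a measure \<Rightarrow> real \<Rightarrow> ('a \<Rightarrow> real) \<Rightarrow> real" where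
  "Lp_norm \<mu> q u = (\<integral>x. \<bar>u x\<bar> powr q \<partial>\<mu>) powr (1 / q)"

text \<open>The infimum and the supremum below are taken in the reals: \<open>Y(g)\<close> is finite by the
  Hoelder inequality, and \<open>\<sigma>(M) \<le> \<sigma>(S\<^sup>n) < \<infinity>\<close> by Aubin's inequality.\<close>

definition yamabe_constant ::
  "('a, 'n::finite) manifold \<Rightarrow> ('a, 'n) metric_coeffs \<Rightarrow> real" where
  "yamabe_constant M g =
     (let \<mu> = volume_measure M g; p = 2 * real CARD('n) / (real CARD('n) - 2)
      in INF u\<in>{u. smooth_fun_on M (points M) u \<and> (\<exists>x\<in>points M. u x \<noteq> 0)}.
           (\<integral>x. u x * conformal_laplacian M g u x \<partial>\<mu>) / (Lp_norm \<mu> p u)\<^sup>2)"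

definition yamabe_invariant :: "('a, 'n::finite) manifold \<Rightarrow> real" where
  "yamabe_invariant M = (SUP g\<in>{g. riemannian_metric M g}. yamabe_constant M g)"


section \<open>Green function and mass\<close>

text \<open>\<open>L\<^sub>g G = \<delta>\<^sub>p\<close> in the sense of distributions, where \<open>L\<^sub>g\<close> is formally self-adjoint. By
  elliptic regularity \<open>G\<close> is smooth outside \<open>p\<close>; \<open>G p\<close> is irrelevant.\<close>

definition green_function ::
  "('a, 'n::finite) manifold \<Rightarrow> ('a, 'n) metric_coeffs \<Rightarrow> 'a \<Rightarrow> ('a \<Rightarrow> real) \<Rightarrow> bool" where
  "green_function M g p G \<longleftrightarrow>
     smooth_fun_on M (points M - {p}) G \<and>
     integrable (volume_measure M g) G \<and>
     (\<forall>u. smooth_fun_on M (points M) u \<longrightarrow>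
        (\<integral>x. G x * conformal_laplacian M g u x \<partial>volume_measure M g) = u p)"

text \<open>Here \<open>\<omega>\<close> is the volume of the unit sphere of \<open>\<real>\<^sup>n\<close>, which is \<open>n\<close> times the volume of
  the unit ball. The mass is only meaningful if \<open>g\<close> is flat near \<open>p\<close> and \<open>Y(g) > 0\<close>.\<close>

definition mass :: "('a, 'n::finite) manifold \<Rightarrow> ('a, 'n) metric_coeffs \<Rightarrow> 'a \<Rightarrow> real" where
  "mass M g p =
     (let n = CARD('n); \<omega> = real n * unit_ball_vol (real n)
      in THE m. \<exists>G. green_function M g p G \<and>
           ((\<lambda>x. G x - 1 / ((real n - 2) * \<omega> * enn2real (riem_dist M g p x) ^ (n - 2))) \<longlongrightarrow> m)
             (atin (mtop M) p))"

definition Omega ::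
  "('a, 'n::finite) manifold \<Rightarrow> real \<Rightarrow> (('a, 'n) metric_coeffs \<times> 'a) set" where
  "Omega M b = {(g, p). riemannian_metric M g \<and> p \<in> points M \<and> yamabe_constant M g > b \<and>
                        isometric_to_unit_ball M g (riem_ball M g p 1)}"

text \<open>Meaningful for \<open>0 \<le> a \<le> \<sigma>(M)\<close>.\<close>

definition upper_mass_function :: "('a, 'n::finite) manifold \<Rightarrow> real \<Rightarrow> ereal" where
  "upper_mass_function M a =
     Limsup (at_right 0) (\<lambda>\<epsilon>. SUP (g, p)\<in>Omega M (max (a - \<epsilon>) 0). ereal (mass M g p))"

end

theory Submission
  imports Defs
begin

text \<open>
  Write \<open>\<sigma> = \<sigma>(M)\<close> and \<open>s = \<sigma>(S\<^sup>n)\<close>, and suppose that \<open>\<sigma> \<ge> s\<close>. The given bound on the upper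
  mass function holds for \<open>M\<close> at every \<open>a = \<sigma> - \<epsilon>\<close> with \<open>0 < \<epsilon> < \<sigma>\<close>, and it yields
  \<open>X(\<sigma> - \<epsilon>) / \<epsilon>\<^sup>1\<^sup>/\<^sup>n \<le> d (s - \<sigma> + \<epsilon>)\<^sup>1\<^sup>/\<^sup>n / ((\<sigma> - \<epsilon>) \<epsilon>\<^sup>1\<^sup>/\<^sup>n)\<close>.
  If \<open>\<sigma> = s\<close>, the right-hand side is \<open>d / (s - \<epsilon>)\<close>, so that the upper limit on the left is at most
  \<open>d / s\<close>, which contradicts the assumed strict inequality.

  If \<open>\<sigma> > s\<close>, then since the real \<open>n\<close>-th root is an odd function, the numerator on the right
  tends to a negative number while the denominator tends to \<open>0\<close> from above. The upper limit is
  then \<open>-\<infinity>\<close>, which contradicts the strict inequality again.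
\<close>

text \<open>
  The behaviour near \<open>\<sigma>\<close> depends only on the bound for \<open>X\<close>. The upper limit equals
  \<open>-\<infinity>\<close> for \<open>s < \<sigma>\<close>, which is below \<open>d / s\<close> also for \<open>s \<le> 0\<close>; for \<open>s = \<sigma>\<close> the
  \<open>n\<close>-th roots cancel.
\<close>

lemma Limsup_root_quotient_le:
  fixes X :: "real \<Rightarrow> ereal" and d s \<sigma> :: real
  assumes n: "n > 0" and d: "d > 0" and \<sigma>: "\<sigma> > 0" and le: "s \<le> \<sigma>"
    and bound: "\<And>a. 0 < a \<Longrightarrow> a < \<sigma> \<Longrightarrow> X a \<le> ereal (d * (root n (s - a) / a))"
  shows "Limsup (at_right 0) (\<lambda>\<epsilon>. X (\<sigma> - \<epsilon>) / ereal (root n \<epsilon>)) \<le> ereal (d / s)"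
proof -
  define h where "h \<epsilon> = d * (root n (s - (\<sigma> - \<epsilon>)) / (\<sigma> - \<epsilon>)) / root n \<epsilon>" for \<epsilon>
  have small: "\<forall>\<^sub>F \<epsilon> in at_right 0. 0 < \<epsilon> \<and> \<epsilon> < \<sigma>"
    using eventually_at_right_field \<sigma> by blast
  have "\<forall>\<^sub>F \<epsilon> in at_right 0. X (\<sigma> - \<epsilon>) / ereal (root n \<epsilon>) \<le> ereal (h \<epsilon>)"
    using small
  proof eventually_elim
    case (elim \<epsilon>)
    have "root n \<epsilon> > 0"
      using n elim by simp
    then show ?case
      using bound[of "\<sigma> - \<epsilon>"] elim ereal_divide_right_mono[of "X (\<sigma> - \<epsilon>)" _ "ereal (root n \<epsilon>)"]
      by (fastforce simp: h_def)
  qed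
  then have upper: "Limsup (at_right 0) (\<lambda>\<epsilon>. X (\<sigma> - \<epsilon>) / ereal (root n \<epsilon>))
      \<le> Limsup (at_right 0) (\<lambda>\<epsilon>. ereal (h \<epsilon>))"
    by (rule Limsup_mono)
  show ?thesis
  proof (cases "s = \<sigma>")
    case True
    have "((\<lambda>\<epsilon>. d / (\<sigma> - \<epsilon>)) \<longlongrightarrow> d / (\<sigma> - 0)) (at_right 0)"
      using \<sigma> by (intro tendsto_intros) auto
    moreover have "\<forall>\<^sub>F \<epsilon> in at_right 0. d / (\<sigma> - \<epsilon>) = h \<epsilon>"
      using small
    proof eventually_elim
      case (elim \<epsilon>)
      then have "root n \<epsilon> > 0"
        using n by simp
      then show ?case
        by (simp add: h_def True)
    qed
    ultimately have "(h \<longlongrightarrow> d / s) (at_right 0)"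
      using tendsto_cong[of "\<lambda>\<epsilon>. d / (\<sigma> - \<epsilon>)" h] True by simp
    then have "Limsup (at_right 0) (\<lambda>\<epsilon>. ereal (h \<epsilon>)) = ereal (d / s)"
      by (intro lim_imp_Limsup) auto
    then show ?thesis
      using upper by simp
  next
    case False
    have numerator: "((\<lambda>\<epsilon>. d * (root n (s - (\<sigma> - \<epsilon>)) / (\<sigma> - \<epsilon>)))
        \<longlongrightarrow> d * (root n (s - (\<sigma> - 0)) / (\<sigma> - 0))) (at_right 0)"
      using \<sigma> by (intro tendsto_intros) auto
    have negative: "d * (root n (s - (\<sigma> - 0)) / (\<sigma> - 0)) < 0"
      using n d \<sigma> le False by (simp add: mult_pos_neg divide_neg_pos)
    have "((\<lambda>\<epsilon>. root n \<epsilon>) \<longlongrightarrow> root n 0) (at_right 0)"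
      by (intro tendsto_intros)
    moreover have "\<forall>\<^sub>F \<epsilon> in at_right 0. root n \<epsilon> > 0"
      using small by eventually_elim (use n in simp)
    ultimately have denominator: "filterlim (\<lambda>\<epsilon>. root n \<epsilon>) (at_right 0) (at_right 0)"
      using n by (auto intro!: tendsto_imp_filterlim_at_right)
    have "filterlim h at_bot (at_right 0)"
      unfolding h_def divide_inverse[of _ "root n _"]
      by (rule filterlim_tendsto_neg_mult_at_bot[OF numerator negative])
        (rule filterlim_compose[OF filterlim_inverse_at_top_right denominator])
    then have "((\<lambda>\<epsilon>. ereal (h \<epsilon>)) \<longlongrightarrow> -\<infinity>) (at_right 0)"
      by (simp add: tendsto_MInfty filterlim_at_bot_dense)
    then have "Limsup (at_right 0) (\<lambda>\<epsilon>. ereal (h \<epsilon>)) = -\<infinity>"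
      by (intro lim_imp_Limsup) auto
    then show ?thesis
      using upper by simp
  qed
qed

theorem corollary6p2:
  fixes d :: real and M :: "('a, 'n::finite) manifold"
  assumes "CARD('n) \<ge> 3"
    and "d > 0"
    and "\<forall>N :: ('a, 'n) manifold. compact_manifold N \<and> yamabe_invariant N > 0 \<longrightarrow>
           (\<forall>a. 0 < a \<and> a < yamabe_invariant N \<longrightarrow>
              upper_mass_function N a \<le>
                ereal (d * (root CARD('n)
                  (yamabe_invariant (sphere_manifold :: ((real ^ 'n) \<times> real, 'n) manifold) - a) / a)))"
    and "compact_manifold M"
    and "yamabe_invariant M > 0"
    and "ereal (d / yamabe_invariant (sphere_manifold :: ((real ^ 'n) \<times> real, 'n) manifold))
           < Limsup (at_right 0) (\<lambda>\<epsilon>. upper_mass_function M (yamabe_invariant M - \<epsilon>)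
                                        / ereal (root CARD('n) \<epsilon>))"
  shows "yamabe_invariant M
           < yamabe_invariant (sphere_manifold :: ((real ^ 'n) \<times> real, 'n) manifold)"
proof (rule ccontr)
  assume "\<not> ?thesis"
  then have "Limsup (at_right 0) (\<lambda>\<epsilon>. upper_mass_function M (yamabe_invariant M - \<epsilon>)
        / ereal (root CARD('n) \<epsilon>))
      \<le> ereal (d / yamabe_invariant (sphere_manifold :: ((real ^ 'n) \<times> real, 'n) manifold))"
    using assms by (intro Limsup_root_quotient_le) auto
  with assms(6) show False
    by simp
qed

end
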